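(* Let $\underline{x}=(x_1,x_2)^T,\ \underline{y}=(y_1,y_2)^T\in\mathbb{F}_q((T^{-1}))^2$ with $x_2\ne0$, $y_2\neq0$, $|x_1|\le|x_2|$, $|y_1|\le|y_2|$, such that $\xi=x_1/x_2\notin\mathbb{F}_q(T)$ and $y_1/y_2\in\mathbb{F}_q(T)$. Write $y_1/y_2=A/B$ with $A,B\in\mathbb{F}_q[T]$ coprime, and let $P_k/Q_k$ be the convergents of $\xi$. For any $k$ with $|Q_k| > |Bx_2/y_2|$ and any $\gamma\in\mathrm{SL}_2(\mathbb{F}_q[T])$ with $|\gamma| < |y_2Q_kQ_{k+1}/x_2|$, one has \[ |\gamma\underline{x} - \underline{y}| \geq \left|\frac{x_2}{BQ_k}\right|. \]
   Context: $\mathbb{F}_q((T^{-1}))$ is the field of formal Laurent series in $T^{-1}$ over the finite field $\mathbb{F}_q$ with absolute value $|x|=q^{\deg x}$, $|0|=0$; for vectors and matrices $|\cdot|$ is the maximum absolute value of the entries; $\mathrm{SL}_2(\mathbb{F}_q[T])$ acts on column vectors by multiplication. Convergents: $\xi=[A_0;A_1,\dots]$ is the continued fraction expansion ($A_i\in\mathbb{F}_q[T]$, $\deg A_i>0$ for $i\ge1$), $Q_{-2}=1,Q_{-1}=0$, $Q_n=A_nQ_{n-1}+Q_{n-2}$ and analogously $P_{-2}=0,P_{-1}=1$, $P_n=A_nP_{n-1}+P_{n-2}$. *)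

theory Defs
  imports "HOL-Analysis.Analysis" "HOL-Computational_Algebra.Formal_Laurent_Series"
begin

text \<open>
  The field \<open>F\<^sub>q((T\<^sup>-\<^sup>1))\<close> is \<^typ>\<open>'a fls\<close> with \<open>'a\<close> a finite field, \<open>q = CARD('a)\<close>. The formal
  variable \<^const>\<open>fls_X\<close> plays the role of \<open>T\<^sup>-\<^sup>1\<close>, so \<open>T\<close> is \<^const>\<open>fls_X_inv\<close>, the coefficient
  of \<open>T\<^sup>n\<close> is the one at index \<open>-n\<close>, and the degree in \<open>T\<close> is minus the subdegree.
\<close>

definition deg_T :: "'a::zero fls \<Rightarrow> int" where
  "deg_T x = - fls_subdegree x"

definition abs_T :: "'a::{field,finite} fls \<Rightarrow> real" where
  "abs_T x = (if x = 0 then 0 else real CARD('a) powi deg_T x)"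

definition of_poly_T :: "'a::field poly \<Rightarrow> 'a fls" where
  "of_poly_T p = poly (map_poly fls_const p) fls_X_inv"

definition rat_T :: "'a::field fls set" where
  "rat_T = {of_poly_T a / of_poly_T b | a b. b \<noteq> 0}"

definition vec_abs_T :: "'a::{field,finite} fls ^ 'n \<Rightarrow> real" where
  "vec_abs_T v = Max (range (\<lambda>i. abs_T (v $ i)))"

definition mat_abs_T :: "'a::{field,finite} fls ^ 'n ^ 'm \<Rightarrow> real" where
  "mat_abs_T M = Max (range (\<lambda>(i, j). abs_T (M $ i $ j)))"

definition SL2 :: "('a::comm_ring_1 ^ 2 ^ 2) set" where
  "SL2 = {\<gamma>. det \<gamma> = 1}"

text \<open>
  The part of a Laurent series that is polynomial in \<open>T\<close>; \<^const>\<open>fls_prpart\<close> omits the constant term.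
\<close>

definition poly_part_T :: "'a::field fls \<Rightarrow> 'a poly" where
  "poly_part_T x = fls_prpart x + [:fls_nth x 0:]"

primrec cf_complete :: "'a::field fls \<Rightarrow> nat \<Rightarrow> 'a fls" where
  "cf_complete \<xi> 0 = \<xi>"
| "cf_complete \<xi> (Suc n) =
     inverse (cf_complete \<xi> n - of_poly_T (poly_part_T (cf_complete \<xi> n)))"

definition cf_coeff :: "'a::field fls \<Rightarrow> nat \<Rightarrow> 'a poly" where
  "cf_coeff \<xi> n = poly_part_T (cf_complete \<xi> n)"

text \<open>
  The recurrences start at index \<open>-2\<close>: the \<open>n\<close>-th values of \<open>cf_P_shift\<close> and \<open>cf_Q_shift\<close> are
  \<open>P\<^bsub>n-2\<^esub>\<close> and \<open>Q\<^bsub>n-2\<^esub>\<close>.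
\<close>

fun cf_P_shift :: "'a::field fls \<Rightarrow> nat \<Rightarrow> 'a poly" where
  "cf_P_shift \<xi> 0 = 0"
| "cf_P_shift \<xi> (Suc 0) = 1"
| "cf_P_shift \<xi> (Suc (Suc n)) = cf_coeff \<xi> n * cf_P_shift \<xi> (Suc n) + cf_P_shift \<xi> n"

fun cf_Q_shift :: "'a::field fls \<Rightarrow> nat \<Rightarrow> 'a poly" where
  "cf_Q_shift \<xi> 0 = 1"
| "cf_Q_shift \<xi> (Suc 0) = 0"
| "cf_Q_shift \<xi> (Suc (Suc n)) = cf_coeff \<xi> n * cf_Q_shift \<xi> (Suc n) + cf_Q_shift \<xi> n"

definition cf_P :: "'a::field fls \<Rightarrow> nat \<Rightarrow> 'a poly" where
  "cf_P \<xi> n = cf_P_shift \<xi> (n + 2)"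

definition cf_Q :: "'a::field fls \<Rightarrow> nat \<Rightarrow> 'a poly" where
  "cf_Q \<xi> n = cf_Q_shift \<xi> (n + 2)"

lemma of_poly_T_0 [simp]: "of_poly_T 0 = 0"
  by (simp add: of_poly_T_def)

lemma of_poly_T_pCons: "of_poly_T (pCons a p) = fls_const a + fls_X_inv * of_poly_T p"
  by (cases "a = 0 \<and> p = 0") (auto simp: of_poly_T_def map_poly_pCons)

lemma of_poly_T_nth:
  "fls_nth (of_poly_T p) n = (if n \<le> 0 then coeff p (nat (- n)) else 0)"
proof (induction p arbitrary: n)
  case 0
  then show ?case by simp
next
  case (pCons a p)
  have "nat (- n) = Suc (nat (- (n + 1)))" if "n < 0"
    using that by linarith
  then show ?case
    by (auto simp: of_poly_T_pCons fls_X_inv_times_conv_shift pCons.IH coeff_pCons split: nat.splits)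
qed

lemma deg_T_of_poly: "deg_T (of_poly_T p) = int (degree p)"
proof (cases "p = 0")
  case True
  then show ?thesis by (simp add: deg_T_def)
next
  case False
  have "fls_subdegree (of_poly_T p) = - int (degree p)"
    using False by (intro fls_subdegree_eqI) (auto simp: of_poly_T_nth intro!: coeff_eq_0)
  then show ?thesis by (simp add: deg_T_def)
qed

lemma frac_part_nth:
  "fls_nth (x - of_poly_T (poly_part_T x)) n = (if n \<le> 0 then 0 else fls_nth x n)"
proof (cases "n < 0")
  case True
  then have "nat (- n) \<noteq> 0" by simp
  then show ?thesis
    using True by (auto simp: of_poly_T_nth poly_part_T_def coeff_pCons split: nat.splits)
next
  case False
  then show ?thesis
    by (cases "n = 0") (auto simp: of_poly_T_nth poly_part_T_def)
qed

lemma of_poly_T_eq_0_iff [simp]: "of_poly_T p = 0 \<longleftrightarrow> p = 0"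
proof
  assume "of_poly_T p = 0"
  then have "coeff p n = 0" for n
    using of_poly_T_nth[of p "- int n"] by simp
  then show "p = 0" by (simp add: poly_eq_iff)
qed simp

lemma of_poly_T_1 [simp]: "of_poly_T 1 = 1"
  by (simp add: of_poly_T_def)

lemma of_poly_T_add: "of_poly_T (p + q) = of_poly_T p + of_poly_T q"
  by (rule fls_eqI) (simp add: of_poly_T_nth)

lemma of_poly_T_mult: "of_poly_T (p * q) = of_poly_T p * of_poly_T q"
proof -
  have smult: "of_poly_T (Polynomial.smult a r) = fls_const a * of_poly_T r" for a r
    by (rule fls_eqI) (simp add: of_poly_T_nth)
  show ?thesis
    by (induction p) (simp_all add: of_poly_T_pCons of_poly_T_add smult algebra_simps)
qed

lemma cf_complete_irrational:
  assumes "\<xi> \<notin> rat_T"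
  shows "cf_complete \<xi> n \<notin> rat_T"
proof (induction n)
  case 0
  then show ?case using assms by simp
next
  case (Suc n)
  define z where "z = cf_complete \<xi> n"
  define c where "c = poly_part_T z"
  show ?case
  proof
    assume "cf_complete \<xi> (Suc n) \<in> rat_T"
    then obtain a b where ab: "b \<noteq> 0" "inverse (z - of_poly_T c) = of_poly_T a / of_poly_T b"
      by (auto simp: rat_T_def z_def c_def)
    then have eq: "z = of_poly_T c + of_poly_T b / of_poly_T a"
      by (metis add.commute diff_add_cancel inverse_divide inverse_inverse_eq)
    have "z \<in> rat_T"
    proof (cases "a = 0")
      case True
      then have "z = of_poly_T c / of_poly_T 1" using eq by simp
      then show ?thesis unfolding rat_T_def by (metis (mono_tags, lifting) mem_Collect_eq one_neq_zero)
    next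
      case False
      then have "z = of_poly_T (c * a + b) / of_poly_T a"
        using eq by (simp add: of_poly_T_add of_poly_T_mult field_simps)
      then show ?thesis using False unfolding rat_T_def by blast
    qed
    then show False using Suc z_def by simp
  qed
qed

lemma degree_cf_coeff_pos:
  assumes "\<xi> \<notin> rat_T"
  shows "degree (cf_coeff \<xi> (Suc n)) > 0"
proof -
  define z where "z = cf_complete \<xi> n"
  define f where "f = z - of_poly_T (poly_part_T z)"
  have "f \<noteq> 0"
  proof
    assume "f = 0"
    then have "z = of_poly_T (poly_part_T z) / of_poly_T 1" by (simp add: f_def)
    then have "z \<in> rat_T" unfolding rat_T_def
      by (metis (mono_tags, lifting) mem_Collect_eq one_neq_zero)
    then show False using cf_complete_irrational[OF assms] z_def by blast
  qed
  moreover have "fls_nth f m = 0" if "m < 1" for m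
    using that unfolding f_def frac_part_nth by simp
  ultimately have sub: "fls_subdegree f \<ge> 1"
    by (intro fls_subdegree_geI) auto
  define d where "d = nat (fls_subdegree f)"
  have d: "fls_subdegree (inverse f) = - int d" "d > 0"
    using sub by (auto simp: d_def fls_inverse_subdegree)
  have "fls_nth (inverse f) (- int d) \<noteq> 0"
    using d \<open>f \<noteq> 0\<close> by (metis nonzero_imp_inverse_nonzero nth_fls_subdegree_nonzero)
  moreover have "cf_coeff \<xi> (Suc n) = poly_part_T (inverse f)"
    by (simp add: cf_coeff_def f_def z_def)
  ultimately have "coeff (cf_coeff \<xi> (Suc n)) d \<noteq> 0"
    using d(2) by (auto simp: poly_part_T_def coeff_pCons split: nat.splits)
  then show ?thesis using d(2) le_degree by (metis less_le_trans)
qed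

end

theory Submission
  imports Defs
begin

text \<open>
  Suppose \<open>\<Lambda> = \<gamma>x - y\<close> were too small, and let \<open>M = \<gamma>(P\<^sub>k, Q\<^sub>k)\<^sup>T\<close>, a pair of polynomials generating the unit ideal.
  Since \<open>y\<close> is proportional to \<open>(A, B)\<close>, the size bounds on \<open>\<Lambda>\<close> and \<open>\<gamma>\<close> force the polynomial
  \<open>B M\<^sub>1 - A M\<^sub>2\<close> to have absolute value less than \<open>1\<close>, hence to vanish, so that
  \<open>M\<^sub>2 dvd B\<close>. But \<open>(\<gamma>x)\<^sub>2\<close> is \<open>x\<^sub>2 M\<^sub>2 / Q\<^sub>k\<close> up to an error smaller than \<open>|y\<^sub>2|\<close>, so
  \<open>|(\<gamma>x)\<^sub>2| < |y\<^sub>2|\<close> and \<open>|\<Lambda>\<^sub>2| = |y\<^sub>2|\<close>, which is too large.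
\<close>

section \<open>The absolute value\<close>

lemma card_field_gt_1: "real CARD('a::{field,finite}) > 1"
proof -
  have "card {0, 1 :: 'a} \<le> CARD('a)"
    by (intro card_mono) auto
  then show ?thesis by simp
qed

lemma abs_T_0 [simp]: "abs_T 0 = 0"
  by (simp add: abs_T_def)

lemma abs_T_pos: "x \<noteq> 0 \<Longrightarrow> abs_T x > 0"
  for x :: "'a::{field,finite} fls"
  using card_field_gt_1[where 'a='a] by (simp add: abs_T_def)

lemma abs_T_nonneg [simp]: "abs_T x \<ge> 0"
  using abs_T_pos[of x] by (cases "x = 0") auto

lemma abs_T_1 [simp]: "abs_T 1 = 1"
  by (simp add: abs_T_def deg_T_def)

lemma abs_T_mult: "abs_T (x * y) = abs_T x * abs_T y"
  for x y :: "'a::{field,finite} fls"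
  using card_field_gt_1[where 'a='a]
  by (auto simp: abs_T_def deg_T_def power_int_diff power_int_minus field_simps)

lemma abs_T_divide: "abs_T (x / y) = abs_T x / abs_T y"
proof (cases "y = 0")
  case False
  then have "abs_T (x / y) * abs_T y = abs_T x"
    by (simp flip: abs_T_mult)
  then show ?thesis
    using abs_T_pos[OF False] by (simp add: field_simps)
qed simp

lemma abs_T_minus [simp]: "abs_T (- x) = abs_T x"
  by (simp add: abs_T_def deg_T_def)

lemma abs_T_mono_deg:
  fixes x y :: "'a::{field,finite} fls"
  assumes "y \<noteq> 0" and "deg_T x \<le> deg_T y"
  shows "abs_T x \<le> abs_T y"
  using assms card_field_gt_1[where 'a='a]
  by (auto simp: abs_T_def intro: power_int_increasing)

lemma abs_T_add_le: "abs_T (x + y) \<le> max (abs_T x) (abs_T y)"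
\<comment> \<open>Vanishing terms are split off because the subdegree of 0 is 0 by convention, so
  \<open>deg_T\<close> does not describe the absolute value there.\<close>
proof (cases "x = 0 \<or> y = 0 \<or> x + y = 0")
  case False
  then have "min (fls_subdegree x) (fls_subdegree y) \<le> fls_subdegree (x + y)"
    by (intro fls_plus_subdegree) auto
  then have "deg_T (x + y) \<le> deg_T x \<or> deg_T (x + y) \<le> deg_T y"
    by (auto simp: deg_T_def min_def split: if_splits)
  then show ?thesis
    using False abs_T_mono_deg by (metis le_max_iff_disj)
qed (auto simp: le_max_iff_disj)

lemma abs_T_add_less: "abs_T x < c \<Longrightarrow> abs_T y < c \<Longrightarrow> abs_T (x + y) < c"
  using abs_T_add_le[of x y] by linarith

lemma abs_T_diff_less: "abs_T x < c \<Longrightarrow> abs_T y < c \<Longrightarrow> abs_T (x - y) < c"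
  using abs_T_add_less[of x c "- y"] by simp

text \<open>The ultrametric inequality is applied a second time to x = (x + y) - y, so that the
  dominant term cannot be cancelled.\<close>

lemma abs_T_add_eq:
  assumes "abs_T y < abs_T x"
  shows "abs_T (x + y) = abs_T x"
  using abs_T_add_le[of x y] abs_T_add_le[of "x + y" "- y"] assms by (simp add: max_def split: if_splits)

lemma of_poly_T_minus: "of_poly_T (- p) = - of_poly_T p"
  by (rule fls_eqI) (simp add: of_poly_T_nth)

lemma of_poly_T_diff: "of_poly_T (p - q) = of_poly_T p - of_poly_T q"
  using of_poly_T_add[of p "- q"] by (simp add: of_poly_T_minus)

lemma abs_T_of_poly_mono:
  "q \<noteq> 0 \<Longrightarrow> degree p \<le> degree q \<Longrightarrow> abs_T (of_poly_T p) \<le> abs_T (of_poly_T q)"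
  for p q :: "'a::{field,finite} poly"
  by (rule abs_T_mono_deg) (auto simp: deg_T_of_poly)

text \<open>This is the discreteness of F_q[T]: in contrapositive form, a polynomial is shown to
  vanish by bounding its absolute value below 1.\<close>

lemma abs_T_of_poly_ge_1: "p \<noteq> 0 \<Longrightarrow> abs_T (of_poly_T p) \<ge> 1"
  using abs_T_of_poly_mono[of p 1] by simp

lemma abs_T_frac_part_less_1: "abs_T (x - of_poly_T (poly_part_T x)) < 1"
  for x :: "'a::{field,finite} fls"
proof -
  define f where "f = x - of_poly_T (poly_part_T x)"
  show ?thesis
  proof (cases "f = 0")
    case False
    have "fls_nth f m = 0" if "m < 1" for m
      using that unfolding f_def frac_part_nth by simp
    then have "deg_T f < 0"
      using False fls_subdegree_geI[of f 1] by (simp add: deg_T_def)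
    then show ?thesis
      using False power_int_strict_increasing[of "deg_T f" 0 "real CARD('a)"]
        card_field_gt_1[where 'a='a]
      unfolding f_def[symmetric] by (simp add: abs_T_def)
  qed (simp add: f_def)
qed

lemma abs_T_le_vec_abs_T: "abs_T (v $ i) \<le> vec_abs_T v"
  unfolding vec_abs_T_def by (rule Max_ge) auto

lemma abs_T_le_mat_abs_T: "abs_T (M $ i $ j) \<le> mat_abs_T M"
  unfolding mat_abs_T_def by (rule Max_ge) (auto intro: image_eqI[of _ _ "(i, j)"])

section \<open>Convergents\<close>

text \<open>Partial quotients after the first are nonconstant by irrationality, so the product term
  dominates the recurrence. Nonvanishing is carried along so that degrees add in that
  product.\<close>

lemma cf_Q_shift_degree_mono:
  assumes "\<xi> \<notin> rat_T"
  shows "cf_Q_shift \<xi> (n + 2) \<noteq> 0 \<and> degree (cf_Q_shift \<xi> (n + 1)) \<le> degree (cf_Q_shift \<xi> (n + 2))"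
proof (induction n)
  case (Suc n)
  let ?a = "cf_coeff \<xi> (Suc n)" and ?q = "cf_Q_shift \<xi> (n + 2)" and ?r = "cf_Q_shift \<xi> (n + 1)"
  have a: "degree ?a > 0" using degree_cf_coeff_pos[OF assms] .
  then have "degree (?a * ?q) = degree ?a + degree ?q"
    using Suc by (intro degree_mult_eq) auto
  then have "degree (?a * ?q + ?r) = degree ?a + degree ?q"
    using Suc a by (subst degree_add_eq_left) auto
  moreover have "cf_Q_shift \<xi> (Suc n + 2) = ?a * ?q + ?r"
    by simp
  moreover have "Suc n + 1 = n + 2"
    by simp
  ultimately show ?case
    using a by (metis add_is_0 degree_0 le_add2 not_gr_zero)
qed simp

lemma cf_Q_nonzero: "\<xi> \<notin> rat_T \<Longrightarrow> cf_Q \<xi> n \<noteq> 0"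
  using cf_Q_shift_degree_mono[of \<xi> n] by (simp add: cf_Q_def)

lemma abs_T_cf_Q_mono:
  "\<xi> \<notin> rat_T \<Longrightarrow> abs_T (of_poly_T (cf_Q \<xi> n)) \<le> abs_T (of_poly_T (cf_Q \<xi> (n + 1)))"
  using cf_Q_shift_degree_mono[of \<xi> "n + 1"] cf_Q_nonzero[of \<xi> "n + 1"]
  by (intro abs_T_of_poly_mono) (auto simp: cf_Q_def)

text \<open>Each step of the recurrences multiplies by a matrix with rows (a, 1) and (1, 0), whose
  determinant is -1.\<close>

lemma cf_shift_det:
  "cf_P_shift \<xi> (Suc n) * cf_Q_shift \<xi> n - cf_P_shift \<xi> n * cf_Q_shift \<xi> (Suc n) = (-1) ^ n"
proof (induction n)
  case (Suc n)
  then show ?case by (simp add: algebra_simps)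
qed simp

text \<open>With z the n-th complete quotient, this is \<xi> = (P_{n-1} z + P_{n-2}) / (Q_{n-1} z +
  Q_{n-2}) cleared of denominators.\<close>

lemma cf_shift_complete:
  assumes "\<xi> \<notin> rat_T"
  shows "(of_poly_T (cf_Q_shift \<xi> (Suc n)) * \<xi> - of_poly_T (cf_P_shift \<xi> (Suc n))) * cf_complete \<xi> n
    + (of_poly_T (cf_Q_shift \<xi> n) * \<xi> - of_poly_T (cf_P_shift \<xi> n)) = 0"
proof (induction n)
  case (Suc n)
  define z where "z = cf_complete \<xi> n"
  define a where "a = of_poly_T (cf_coeff \<xi> n)"
  define D where "D m = of_poly_T (cf_Q_shift \<xi> m) * \<xi> - of_poly_T (cf_P_shift \<xi> m)" for m
  have "cf_complete \<xi> (Suc n) = inverse (z - a)"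
    by (simp add: z_def a_def cf_coeff_def)
  \<comment> \<open>Since \<open>inverse 0 = 0\<close>, this rules out z = a.\<close>
  moreover have "cf_complete \<xi> (Suc n) \<noteq> 0"
    using cf_complete_irrational[OF assms, of "Suc n"]
    unfolding rat_T_def by (metis (mono_tags, lifting) div_0 mem_Collect_eq of_poly_T_0 one_neq_zero)
  ultimately have inv: "(z - a) * cf_complete \<xi> (Suc n) = 1"
    by (metis inverse_zero right_inverse)
  have IH: "D n = - (D (Suc n) * z)"
    using Suc by (simp add: D_def z_def add_eq_0_iff)
  have "D (Suc (Suc n)) = a * D (Suc n) + D n"
    by (simp add: D_def a_def of_poly_T_add of_poly_T_mult algebra_simps)
  then have "D (Suc (Suc n)) = - D (Suc n) * (z - a)"
    by (simp add: IH algebra_simps)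
  then have "D (Suc (Suc n)) * cf_complete \<xi> (Suc n) + D (Suc n) = 0"
    using inv by (simp add: mult.assoc)
  then show ?case by (simp only: D_def)
qed simp

text \<open>The exact value comes from Q_k \<xi> - P_k being, up to sign, the inverse of Q_k z +
  Q_{k-1}, where z is the complete quotient of index k + 1; that denominator has the size of
  Q_{k+1}.\<close>

lemma abs_T_convergent_error:
  assumes "\<xi> \<notin> rat_T"
  shows "abs_T (of_poly_T (cf_Q \<xi> k) * \<xi> - of_poly_T (cf_P \<xi> k)) * abs_T (of_poly_T (cf_Q \<xi> (k + 1))) = 1"
proof -
  define z where "z = cf_complete \<xi> (k + 1)"
  define a where "a = cf_coeff \<xi> (k + 1)"
  \<comment> \<open>Because of the index shift, the primed pair is P_{k-1}, Q_{k-1}.\<close>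
  define P Q P' Q' where "P = of_poly_T (cf_P \<xi> k)" and "Q = of_poly_T (cf_Q \<xi> k)"
    and "P' = of_poly_T (cf_P_shift \<xi> (k + 1))" and "Q' = of_poly_T (cf_Q_shift \<xi> (k + 1))"
  have Q0: "Q \<noteq> 0" and le: "abs_T Q \<le> abs_T (of_poly_T (cf_Q \<xi> (k + 1)))"
    using cf_Q_nonzero[OF assms] abs_T_cf_Q_mono[OF assms] by (auto simp: Q_def)
  have "(Q * \<xi> - P) * z + (Q' * \<xi> - P') = 0"
    using cf_shift_complete[OF assms, of "k + 1"]
    by (simp add: P_def Q_def P'_def Q'_def z_def cf_P_def cf_Q_def)
  then have "(Q * \<xi> - P) * z = - (Q' * \<xi> - P')"
    by (simp add: add_eq_0_iff2)
  \<comment> \<open>Substituting for the product with z makes \<xi> cancel, which leaves the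
    determinant of two consecutive convergents.\<close>
  then have "(Q * \<xi> - P) * (Q * z + Q') = - (Q * (Q' * \<xi> - P')) + Q' * (Q * \<xi> - P)"
    by (simp add: distrib_left minus_mult_right mult.left_commute[of _ Q z] mult.commute[of _ Q'])
  also have "\<dots> = - of_poly_T (cf_P \<xi> k * cf_Q_shift \<xi> (k + 1) - cf_P_shift \<xi> (k + 1) * cf_Q \<xi> k)"
    by (simp add: P_def Q_def P'_def Q'_def of_poly_T_diff of_poly_T_mult algebra_simps)
  also have "\<dots> = - of_poly_T ((-1) ^ Suc k)"
    using cf_shift_det[of \<xi> "k + 1"] by (simp add: cf_P_def cf_Q_def)
  finally have "(Q * \<xi> - P) * (Q * z + Q') = - of_poly_T ((-1) ^ Suc k)" .
  moreover have "(-1) ^ Suc k = (1 :: 'a poly) \<or> (-1) ^ Suc k = (-1 :: 'a poly)"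
    by (cases "even k") auto
  ultimately have "abs_T (Q * \<xi> - P) * abs_T (Q * z + Q') = 1"
    by (metis abs_T_1 abs_T_minus abs_T_mult of_poly_T_1 of_poly_T_minus)
  moreover have "abs_T (Q * z + Q') = abs_T (of_poly_T (cf_Q \<xi> (k + 1)))"
  proof -
    \<comment> \<open>Replacing z by its polynomial part \<open>a\<close> gives Q_{k+1}; the error
      is Q_k times a fractional part, hence smaller than Q_{k+1}.\<close>
    have "Q * z + Q' = of_poly_T (cf_Q \<xi> (k + 1)) + Q * (z - of_poly_T a)"
      by (simp add: Q_def Q'_def a_def cf_Q_def of_poly_T_add of_poly_T_mult algebra_simps)
    moreover have "abs_T (z - of_poly_T a) < 1"
      using abs_T_frac_part_less_1 by (simp add: z_def a_def cf_coeff_def)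
    then have "abs_T (Q * (z - of_poly_T a)) < abs_T Q"
      using abs_T_pos[OF Q0] by (simp add: abs_T_mult)
    ultimately show ?thesis
      using le by (simp add: abs_T_add_eq)
  qed
  ultimately show ?thesis by (simp add: P_def Q_def)
qed

section \<open>The lower bound\<close>

theorem theorem4p6:
  fixes x y :: "'a::{field,finite} fls ^ 2"
    and A B :: "'a poly" and k :: nat and \<gamma> :: "'a poly ^ 2 ^ 2" and \<xi> :: "'a fls"
  assumes "x $ 2 \<noteq> 0" and "y $ 2 \<noteq> 0"
    and "abs_T (x $ 1) \<le> abs_T (x $ 2)" and "abs_T (y $ 1) \<le> abs_T (y $ 2)"
    and "\<xi> = x $ 1 / x $ 2" and "\<xi> \<notin> rat_T"
    and "y $ 1 / y $ 2 \<in> rat_T"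
    and "B \<noteq> 0" and "coprime A B" and "y $ 1 / y $ 2 = of_poly_T A / of_poly_T B"
    and "abs_T (of_poly_T (cf_Q \<xi> k)) > abs_T (of_poly_T B * x $ 2 / y $ 2)"
    and "\<gamma> \<in> SL2"
    and "mat_abs_T (map_matrix of_poly_T \<gamma>)
           < abs_T (y $ 2 * of_poly_T (cf_Q \<xi> k) * of_poly_T (cf_Q \<xi> (k + 1)) / x $ 2)"
  shows "vec_abs_T (map_matrix of_poly_T \<gamma> *v x - y)
           \<ge> abs_T (x $ 2 / (of_poly_T B * of_poly_T (cf_Q \<xi> k)))"
proof (rule ccontr)
  define x2 y2 where "x2 = x $ 2" and "y2 = y $ 2"
  define a b where "a = of_poly_T A" and "b = of_poly_T B"
  define P Q Q' where "P = of_poly_T (cf_P \<xi> k)" and "Q = of_poly_T (cf_Q \<xi> k)"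
    and "Q' = of_poly_T (cf_Q \<xi> (k + 1))"
  define v1 u1 v2 u2 where "v1 = of_poly_T (\<gamma> $ 1 $ 1)" and "u1 = of_poly_T (\<gamma> $ 1 $ 2)"
    and "v2 = of_poly_T (\<gamma> $ 2 $ 1)" and "u2 = of_poly_T (\<gamma> $ 2 $ 2)"
  define \<Lambda> where "\<Lambda> = map_matrix of_poly_T \<gamma> *v x - y"
  define M1 M2 where "M1 = \<gamma> $ 1 $ 1 * cf_P \<xi> k + \<gamma> $ 1 $ 2 * cf_Q \<xi> k"
    and "M2 = \<gamma> $ 2 $ 1 * cf_P \<xi> k + \<gamma> $ 2 $ 2 * cf_Q \<xi> k"
  assume "\<not> ?thesis"
  then have "vec_abs_T \<Lambda> < abs_T (x2 / (b * Q))"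
    by (simp add: \<Lambda>_def x2_def b_def Q_def)
  then have L: "abs_T (\<Lambda> $ i) < abs_T x2 / (abs_T b * abs_T Q)" for i
    using abs_T_le_vec_abs_T[of \<Lambda> i] by (simp add: abs_T_divide abs_T_mult)
  have pos: "abs_T x2 > 0" "abs_T y2 > 0" "abs_T b > 0" "abs_T Q > 0" "abs_T Q' > 0"
    using assms cf_Q_nonzero[OF assms(6)]
    by (auto simp: x2_def y2_def b_def Q_def Q'_def intro!: abs_T_pos)
  then have nz: "x2 \<noteq> 0" "y2 \<noteq> 0" "b \<noteq> 0" "Q \<noteq> 0" "Q' \<noteq> 0"
    by auto
  have QQ': "abs_T Q \<le> abs_T Q'"
    using abs_T_cf_Q_mono[OF assms(6)] by (simp add: Q_def Q'_def)
  have b1: "abs_T b \<ge> 1"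
    using assms(8) by (simp add: b_def abs_T_of_poly_ge_1)
  have y1: "y $ 1 = y2 * a / b"
    using assms(2,10) by (simp add: y2_def a_def b_def field_simps)
  have ab: "abs_T a \<le> abs_T b"
    using assms(4) pos unfolding y1 y2_def[symmetric] by (simp add: abs_T_divide abs_T_mult field_simps)
  have x1: "x $ 1 = x2 * \<xi>"
    using assms(1,5) by (simp add: x2_def)
  have Qgt: "abs_T b * abs_T x2 < abs_T Q * abs_T y2"
    using assms(11) pos unfolding x2_def[symmetric] y2_def[symmetric] b_def[symmetric] Q_def[symmetric]
    by (simp add: abs_T_divide abs_T_mult field_simps)
  have g: "abs_T (of_poly_T (\<gamma> $ i $ j)) < abs_T y2 * abs_T Q * abs_T Q' / abs_T x2" for i j
    using assms(13) abs_T_le_mat_abs_T[of "map_matrix of_poly_T \<gamma>" i j]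
    unfolding x2_def[symmetric] y2_def[symmetric] Q'_def[symmetric] Q_def[symmetric]
    by (simp add: abs_T_divide abs_T_mult map_matrix_def)
  have det: "\<gamma> $ 1 $ 1 * \<gamma> $ 2 $ 2 - \<gamma> $ 1 $ 2 * \<gamma> $ 2 $ 1 = 1"
    using assms(12) by (simp add: SL2_def det_2)
  then have det': "v1 * u2 - u1 * v2 = 1"
    unfolding v1_def u1_def v2_def u2_def by (metis of_poly_T_1 of_poly_T_diff of_poly_T_mult)
  have L1: "\<Lambda> $ 1 = x2 * (v1 * \<xi> + u1) - y2 * a / b"
    using y1 x1 by (simp add: \<Lambda>_def matrix_vector_mult_def map_matrix_def sum_2 v1_def u1_def x2_def algebra_simps)
  have L2: "\<Lambda> $ 2 = x2 * (v2 * \<xi> + u2) - y2"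
    using x1 by (simp add: \<Lambda>_def matrix_vector_mult_def map_matrix_def sum_2 v2_def u2_def x2_def y2_def algebra_simps)
  have err: "abs_T (Q * \<xi> - P) = 1 / abs_T Q'"
    using abs_T_convergent_error[OF assms(6), of k] pos
    by (simp add: P_def Q_def Q'_def field_simps)

  \<comment> \<open>The row (s, t) is (b, -a) times \<gamma>. The functional (b, -a) annihilates y,
    so on \<Lambda> it only sees \<gamma>x.\<close>
  define s t where "s = b * v1 - a * v2" and "t = b * u1 - a * u2"
  have "x2 * (s * \<xi> + t) = b * \<Lambda> $ 1 - a * \<Lambda> $ 2"
    using nz by (simp add: L1 L2 s_def t_def field_simps)
  moreover have "abs_T (b * \<Lambda> $ 1) < abs_T x2 / abs_T Q"
    using L[of 1] pos by (simp add: abs_T_mult field_simps)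
  moreover have "abs_T (a * \<Lambda> $ 2) < abs_T x2 / abs_T Q"
  proof -
    have "abs_T (a * \<Lambda> $ 2) \<le> abs_T b * abs_T (\<Lambda> $ 2)"
      using ab by (simp add: abs_T_mult mult_right_mono)
    also have "\<dots> < abs_T x2 / abs_T Q"
      using L[of 2] pos by (simp add: field_simps)
    finally show ?thesis .
  qed
  ultimately have "abs_T (x2 * (s * \<xi> + t)) < abs_T x2 / abs_T Q"
    by (simp add: abs_T_diff_less)
  then have "abs_T (s * \<xi> + t) < 1 / abs_T Q"
    using pos by (simp add: abs_T_mult divide_inverse)
  then have st: "abs_T (Q * (s * \<xi> + t)) < 1"
    using pos by (simp add: abs_T_mult pos_less_divide_eq mult.commute)

  \<comment> \<open>Estimating \<open>s\<close> by |b||\<gamma>| would be too weak. Instead,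
    Cramer's rule recovers \<open>x2\<close> from \<gamma>x = \<Lambda> + y, and the contribution of
    y is exactly (y2/b) s.\<close>
  have s: "abs_T s < abs_T Q'"
  proof -
    have gL: "abs_T (of_poly_T (\<gamma> $ i $ j) * \<Lambda> $ l) < abs_T y2 * abs_T Q' / abs_T b" for i j l
    proof -
      have "abs_T (of_poly_T (\<gamma> $ i $ j) * \<Lambda> $ l)
          < (abs_T y2 * abs_T Q * abs_T Q' / abs_T x2) * (abs_T x2 / (abs_T b * abs_T Q))"
        unfolding abs_T_mult by (rule mult_strict_mono'[OF g L]) auto
      also have "\<dots> = abs_T y2 * abs_T Q' / abs_T b"
        using pos by simp
      finally show ?thesis .
    qed
    have "x2 = x2 * (v1 * u2 - u1 * v2)"
      by (simp add: det')
    also have "\<dots> = v1 * (\<Lambda> $ 2 + y2) - v2 * (\<Lambda> $ 1 + y2 * a / b)"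
      by (simp add: L1 L2 algebra_simps)
    finally have "y2 / b * s = x2 - (v1 * \<Lambda> $ 2 - v2 * \<Lambda> $ 1)"
      using nz by (simp add: s_def field_simps)
    moreover have "abs_T x2 < abs_T y2 * abs_T Q' / abs_T b"
    proof -
      have "abs_T b * abs_T x2 < abs_T Q' * abs_T y2"
        using Qgt QQ' pos by (smt (verit) mult_right_mono)
      then show ?thesis using pos by (simp add: field_simps)
    qed
    ultimately have "abs_T (y2 / b * s) < abs_T y2 * abs_T Q' / abs_T b"
      using gL by (simp add: abs_T_diff_less v1_def v2_def)
    then show ?thesis
      using pos by (simp add: abs_T_mult abs_T_divide field_simps)
  qed

  \<comment> \<open>The left side is s P_k + t Q_k. Both terms on the right are below 1, the second
    by the bound on \<open>s\<close> and the convergent error 1/|Q_{k+1}|.\<close>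
  have "of_poly_T (B * M1 - A * M2) = Q * (s * \<xi> + t) - s * (Q * \<xi> - P)"
    by (simp add: M1_def M2_def s_def t_def a_def b_def P_def Q_def v1_def u1_def v2_def u2_def
        of_poly_T_add of_poly_T_mult of_poly_T_diff algebra_simps)
  moreover have "abs_T (s * (Q * \<xi> - P)) < 1"
    using s pos by (simp add: abs_T_mult err)
  ultimately have "abs_T (of_poly_T (B * M1 - A * M2)) < 1"
    using st by (simp add: abs_T_diff_less)
  then have "B * M1 = A * M2"
    using abs_T_of_poly_ge_1[of "B * M1 - A * M2"] by fastforce
  \<comment> \<open>These are P_{k-1} and Q_{k-1}. Their image (N1, N2) under \<gamma> completes
    (M1, M2) to a matrix of determinant 1 or -1, a Bezout identity for M1 and M2.\<close>
  define P' R' where "P' = cf_P_shift \<xi> (k + 1)" and "R' = cf_Q_shift \<xi> (k + 1)"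
  define N1 N2 where "N1 = \<gamma> $ 1 $ 1 * P' + \<gamma> $ 1 $ 2 * R'"
    and "N2 = \<gamma> $ 2 $ 1 * P' + \<gamma> $ 2 $ 2 * R'"
  have "M1 * N2 - M2 * N1 = (\<gamma> $ 1 $ 1 * \<gamma> $ 2 $ 2 - \<gamma> $ 1 $ 2 * \<gamma> $ 2 $ 1)
      * (cf_P \<xi> k * R' - P' * cf_Q \<xi> k)"
    by (simp add: M1_def M2_def N1_def N2_def algebra_simps)
  then have unit: "M1 * N2 - M2 * N1 = (-1) ^ Suc k"
    using cf_shift_det[of \<xi> "k + 1"] by (simp add: det P'_def R'_def cf_P_def cf_Q_def)
  have "B * (M1 * N2 - M2 * N1) = (B * M1) * N2 - B * M2 * N1"
    by (simp add: algebra_simps)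
  also have "\<dots> = M2 * (A * N2 - B * N1)"
    using \<open>B * M1 = A * M2\<close> by (simp add: algebra_simps)
  finally have "M2 dvd B * (-1) ^ Suc k"
    by (simp add: unit)
  then have "M2 dvd B"
    by (cases "even k") simp_all
  then have M2: "abs_T (of_poly_T M2) \<le> abs_T b"
    using assms(8) unfolding b_def by (intro abs_T_of_poly_mono dvd_imp_degree_le)

  \<comment> \<open>Here \<xi> is replaced by P_k/Q_k plus its error. The bound on |\<gamma>| is
    what keeps the error term below |y2|.\<close>
  have "x2 * (v2 * \<xi> + u2) = x2 * of_poly_T M2 / Q + x2 * v2 * (Q * \<xi> - P) / Q"
    using nz by (simp add: M2_def P_def Q_def v2_def u2_def of_poly_T_add of_poly_T_mult field_simps)
  moreover have "abs_T (x2 * of_poly_T M2 / Q) < abs_T y2"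
  proof -
    have "abs_T x2 * abs_T (of_poly_T M2) < abs_T y2 * abs_T Q"
      using M2 Qgt pos by (smt (verit) mult.commute mult_right_mono)
    then show ?thesis using pos by (simp add: abs_T_mult abs_T_divide field_simps)
  qed
  moreover have "abs_T (x2 * v2 * (Q * \<xi> - P) / Q) < abs_T y2"
    using g[of 2 1] pos unfolding abs_T_mult abs_T_divide err v2_def
    by (simp add: field_simps)
  ultimately have "abs_T (x2 * (v2 * \<xi> + u2)) < abs_T y2"
    by (simp add: abs_T_add_less)
  then have "abs_T (\<Lambda> $ 2) = abs_T y2"
    using abs_T_add_eq[of "x2 * (v2 * \<xi> + u2)" "- y2"] by (simp add: L2 add.commute)
  \<comment> \<open>The assumed upper bound for the second entry of \<Lambda> is thus at most |y2|,
    contradicting the equality just obtained.\<close>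
  moreover have "abs_T x2 / (abs_T b * abs_T Q) \<le> abs_T y2"
  proof -
    have "abs_T x2 \<le> abs_T b * abs_T x2"
      using b1 pos by simp
    also have "\<dots> \<le> abs_T Q * abs_T y2"
      using Qgt by simp
    also have "\<dots> \<le> abs_T b * (abs_T Q * abs_T y2)"
      using b1 pos by simp
    finally show ?thesis
      using pos by (simp add: field_simps)
  qed
  ultimately show False
    using L[of 2] by simp
qed

end
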